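(* Let $N\ge 2$ be an integer, let $t_f>0$ and $\Delta t=t_f/(N-1)$, let $\mathbf g\in\mathbb R^3$, $\mathbf x_0,\mathbf x_f\in\mathbb R^6$, and let the scaling matrices $S_x,S_u$, the normalized matrices $\hat A,\hat B_0,\hat B_1,\hat{\mathbf d}$, the sensitivity matrix $G=\Gamma_N\in\mathbb R^{6\times 3N}$, the zero-control trajectory $\hat{\mathbf x}^{(0)}_k$, and $\hat{\mathbf x}_f$ be as defined in the context. Suppose every row of $G$ is nonzero, and let $$D=\operatorname{diag}\left(\frac{1}{\lVert G_{1,:}\rVert_2},\ldots,\frac{1}{\lVert G_{6,:}\rVert_2}\right),\qquad H_c=DG,\qquad \mathbf h_c=D\left(\hat{\mathbf x}_f-\hat{\mathbf x}^{(0)}_N\right).$$ Then for every stacked normalized control $\hat{\mathbf U}\in\mathbb R^{3N}$, the equality $H_c\hat{\mathbf U}=\mathbf h_c$ holds if and only if the trajectory $\hat{\mathbf x}_1,\ldots,\hat{\mathbf x}_N$ generated by $\hat{\mathbf U}$ through the normalized discrete dynamics from $\hat{\mathbf x}_1=S_x^{-1}\mathbf x_0$ satisfies the terminal condition $\hat{\mathbf x}_N=\hat{\mathbf x}_f$. Moreover, condensation (replacing the full-state formulation by the condensed formulation, both defined in the context) changes neither the feasible control set nor the value of any control-only objective: for any set $\mathcal C\subseteq\mathbb R^{3N}$ of admissible controls, the set of controls $\hat{\mathbf U}$ that are feasible for the full-state formulation equals the set of controls feasible for the condensed formulation, and for any objective that is a function of $\hat{\mathbf U}$ only, its value at each feasible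 control is the same in the two formulations.
   Context: Discrete dynamics. For states $\mathbf x_k=[\mathbf r_k^{\mathsf T},\mathbf v_k^{\mathsf T}]^{\mathsf T}\in\mathbb R^6$ (position and velocity) and controls $\mathbf u_k\in\mathbb R^3$, $k=1,\ldots,N$, $$\mathbf x_{k+1}=A\mathbf x_k+B_0\mathbf u_k+B_1\mathbf u_{k+1}+\mathbf d,\qquad k=1,\ldots,N-1,\qquad \mathbf x_1=\mathbf x_0,$$ with $$A=\begin{bmatrix}I_3&\Delta t I_3\\0&I_3\end{bmatrix},\quad B_0=B_1=\begin{bmatrix}\frac{\Delta t^2}{4}I_3\\ \frac{\Delta t}{2}I_3\end{bmatrix},\quad \mathbf d=\begin{bmatrix}\frac{\Delta t^2}{2}\mathbf g\\ \Delta t\,\mathbf g\end{bmatrix}.$$ Normalization. $P_r,P_v,P_u\in\mathbb R^{3\times3}$ are diagonal and positive definite, $S_x=\operatorname{blkdiag}(P_r,P_v)$, $S_u=P_u$, $\mathbf x_k=S_x\hat{\mathbf x}_k$, $\mathbf u_k=S_u\hat{\mathbf u}_k$, $\hat{\mathbf x}_f=S_x^{-1}\mathbf x_f$, and $$\hat A=S_x^{-1}AS_x,\qquad \hat B_i=S_x^{-1}B_iS_u\ (i=0,1),\qquad \hat{\mathbf d}=S_x^{-1}\mathbf d.$$ The normalized discrete dynamics are $\hat{\mathbf x}_{k+1}=\hat A\hat{\mathbf x}_k+\hat B_0\hat{\mathbf u}_k+\hat B_1\hat{\mathbf u}_{k+1}+\hat{\mathbf d}$ for $k=1,\ldots,N-1$,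 with $\hat{\mathbf x}_1=S_x^{-1}\mathbf x_0$. Sensitivity recursion. $\hat{\mathbf U}=[\hat{\mathbf u}_1^{\mathsf T},\ldots,\hat{\mathbf u}_N^{\mathsf T}]^{\mathsf T}\in\mathbb R^{3N}$ and $E_k\in\mathbb R^{3\times 3N}$ selects the $k$th block, $E_k\hat{\mathbf U}=\hat{\mathbf u}_k$. Define $\hat{\mathbf x}^{(0)}_k\in\mathbb R^6$ and $\Gamma_k\in\mathbb R^{6\times3N}$ by $$\hat{\mathbf x}^{(0)}_1=S_x^{-1}\mathbf x_0,\quad \Gamma_1=0,\quad \hat{\mathbf x}^{(0)}_{k+1}=\hat A\hat{\mathbf x}^{(0)}_k+\hat{\mathbf d},\quad \Gamma_{k+1}=\hat A\Gamma_k+\hat B_0E_k+\hat B_1E_{k+1},$$ and $G=\Gamma_N$. $G_{i,:}$ denotes the $i$th row of $G$. Formulations. Let $\mathcal C\subseteq\mathbb R^{3N}$ be a control constraint set (there are no constraints on intermediate states). A control $\hat{\mathbf U}$ is feasible for the full-state formulation if $\hat{\mathbf U}\in\mathcal C$ and there exist states $\hat{\mathbf x}_1,\ldots,\hat{\mathbf x}_N$ satisfying the normalized discrete dynamics, the initial condition $\hat{\mathbf x}_1=S_x^{-1}\mathbf x_0$ and the terminal condition $\hat{\mathbf x}_N=\hat{\mathbf x}_f$. It is feasible for the condensed formulation if $\hat{\mathbf U}\in\mathcal C$ and $H_c\hat{\mathbf U}=\mathbf h_c$. *)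

theory Defs
  imports Complex_Main "Jordan_Normal_Form.Gauss_Jordan_Elimination"
begin

definition pos_def_mat :: "real mat \<Rightarrow> bool" where
  "pos_def_mat M \<longleftrightarrow> square_mat M \<and> M\<^sup>T = M \<and>
     (\<forall>v \<in> carrier_vec (dim_row M). v \<noteq> 0\<^sub>v (dim_row M) \<longrightarrow> v \<bullet> (M *\<^sub>v v) > 0)"

definition inv_mat :: "real mat \<Rightarrow> real mat" where
  "inv_mat M = the (mat_inverse M)"

definition norm2_vec :: "real vec \<Rightarrow> real" where
  "norm2_vec v = sqrt (v \<bullet> v)"

definition dyn_A :: "real \<Rightarrow> real mat" where
  "dyn_A dt = four_block_mat (1\<^sub>m 3) (dt \<cdot>\<^sub>m 1\<^sub>m 3) (0\<^sub>m 3 3) (1\<^sub>m 3)"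

definition dyn_B :: "real \<Rightarrow> real mat" where
  "dyn_B dt = ((dt\<^sup>2 / 4) \<cdot>\<^sub>m 1\<^sub>m 3) @\<^sub>r ((dt / 2) \<cdot>\<^sub>m 1\<^sub>m 3)"

definition dyn_d :: "real \<Rightarrow> real vec \<Rightarrow> real vec" where
  "dyn_d dt g = ((dt\<^sup>2 / 2) \<cdot>\<^sub>v g) @\<^sub>v (dt \<cdot>\<^sub>v g)"

definition blkdiag2 :: "real mat \<Rightarrow> real mat \<Rightarrow> real mat" where
  "blkdiag2 P Q = four_block_mat P (0\<^sub>m (dim_row P) (dim_col Q)) (0\<^sub>m (dim_row Q) (dim_col P)) Q"

(* Time indices run over 1..N, while the entries of vectors and matrices are numbered from 0.
   Block k of a stacked control therefore occupies the entries 3(k-1), 3(k-1)+1, 3(k-1)+2. *)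

definition control_block :: "real vec \<Rightarrow> nat \<Rightarrow> real vec" where
  "control_block U k = vec 3 (\<lambda>i. U $ (3 * (k - 1) + i))"

definition selector :: "nat \<Rightarrow> nat \<Rightarrow> real mat" where
  "selector N k = mat 3 (3 * N) (\<lambda>(i, j). if j = 3 * (k - 1) + i then 1 else 0)"

lemma selector_mult_vec:
  assumes "U \<in> carrier_vec (3 * N)" and "1 \<le> k" and "k \<le> N"
  shows "selector N k *\<^sub>v U = control_block U k"
proof (rule eq_vecI)
  fix i assume "i < dim_vec (control_block U k)"
  then have i: "i < 3" by (simp add: control_block_def)
  with assms have j: "3 * (k - 1) + i < 3 * N" by linarith
  have "(selector N k *\<^sub>v U) $ i =
      (\<Sum>j \<in> {0..<3 * N}. (if j = 3 * (k - 1) + i then 1 else 0) * U $ j)"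
    using assms(1) i by (simp add: selector_def scalar_prod_def)
  also have "\<dots> = (\<Sum>j \<in> {0..<3 * N}. if j = 3 * (k - 1) + i then U $ j else 0)"
    by (rule sum.cong) auto
  also have "\<dots> = U $ (3 * (k - 1) + i)"
    using j by simp
  finally show "(selector N k *\<^sub>v U) $ i = control_block U k $ i"
    using i by (simp add: control_block_def)
qed (simp add: selector_def control_block_def)

(* In the three recursions below the value at time index 0 is a dummy: the recursions start at 1. *)

fun zero_control_state :: "real mat \<Rightarrow> real vec \<Rightarrow> real vec \<Rightarrow> nat \<Rightarrow> real vec" where
  "zero_control_state A d x1 0 = x1"
| "zero_control_state A d x1 (Suc 0) = x1"
| "zero_control_state A d x1 (Suc (Suc k)) = A *\<^sub>v zero_control_state A d x1 (Suc k) + d"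

fun sensitivity :: "real mat \<Rightarrow> real mat \<Rightarrow> real mat \<Rightarrow> nat \<Rightarrow> nat \<Rightarrow> real mat" where
  "sensitivity A B0 B1 N 0 = 0\<^sub>m 6 (3 * N)"
| "sensitivity A B0 B1 N (Suc 0) = 0\<^sub>m 6 (3 * N)"
| "sensitivity A B0 B1 N (Suc (Suc k)) =
     A * sensitivity A B0 B1 N (Suc k) + B0 * selector N (Suc k) + B1 * selector N (Suc (Suc k))"

fun generated_state ::
    "real mat \<Rightarrow> real mat \<Rightarrow> real mat \<Rightarrow> real vec \<Rightarrow> real vec \<Rightarrow> real vec \<Rightarrow> nat \<Rightarrow> real vec" where
  "generated_state A B0 B1 d x1 U 0 = x1"
| "generated_state A B0 B1 d x1 U (Suc 0) = x1"
| "generated_state A B0 B1 d x1 U (Suc (Suc k)) =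
     A *\<^sub>v generated_state A B0 B1 d x1 U (Suc k)
     + B0 *\<^sub>v control_block U (Suc k) + B1 *\<^sub>v control_block U (Suc (Suc k)) + d"

definition row_normalizer :: "real mat \<Rightarrow> real mat" where
  "row_normalizer G = mat_diag (dim_row G) (\<lambda>i. 1 / norm2_vec (row G i))"

(* Only the values x 1, ..., x N of a state sequence x are meaningful. *)

definition full_state_admissible ::
    "real mat \<Rightarrow> real mat \<Rightarrow> real mat \<Rightarrow> real vec \<Rightarrow> real vec \<Rightarrow> real vec \<Rightarrow> nat
      \<Rightarrow> real vec \<Rightarrow> (nat \<Rightarrow> real vec) \<Rightarrow> bool" where
  "full_state_admissible A B0 B1 d x1 xf N U x \<longleftrightarrow>
     (\<forall>k \<in> {1..N}. x k \<in> carrier_vec 6) \<and>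
     x 1 = x1 \<and>
     (\<forall>k \<in> {1..<N}. x (k + 1) =
        A *\<^sub>v x k + B0 *\<^sub>v control_block U k + B1 *\<^sub>v control_block U (k + 1) + d) \<and>
     x N = xf"

definition full_state_feasible ::
    "real mat \<Rightarrow> real mat \<Rightarrow> real mat \<Rightarrow> real vec \<Rightarrow> real vec \<Rightarrow> real vec \<Rightarrow> nat
      \<Rightarrow> real vec set \<Rightarrow> real vec set" where
  "full_state_feasible A B0 B1 d x1 xf N C =
     {U \<in> C. \<exists>x. full_state_admissible A B0 B1 d x1 xf N U x}"

definition condensed_feasible :: "real mat \<Rightarrow> real vec \<Rightarrow> real vec set \<Rightarrow> real vec set" where
  "condensed_feasible H h C = {U \<in> C. H *\<^sub>v U = h}"

(* The full-state formulation has decision variables (x, U) and objective J x U, whereas the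
   condensed formulation has only U. That J is control-only, with condensed objective phi, means
   that J x U does not depend on x and equals phi U. *)

definition control_only_objective ::
    "nat \<Rightarrow> ((nat \<Rightarrow> real vec) \<Rightarrow> real vec \<Rightarrow> real) \<Rightarrow> (real vec \<Rightarrow> real) \<Rightarrow> bool" where
  "control_only_objective N J \<phi> \<longleftrightarrow>
     (\<forall>x. \<forall>U \<in> carrier_vec (3 * N). (\<forall>k \<in> {1..N}. x k \<in> carrier_vec 6) \<longrightarrow> J x U = \<phi> U)"

(* The objective values attained at the control U by the full-state formulation; they are
   collected in a set because the states accompanying U are decision variables as well. *)

definition full_state_values ::
    "real mat \<Rightarrow> real mat \<Rightarrow> real mat \<Rightarrow> real vec \<Rightarrow> real vec \<Rightarrow> real vec \<Rightarrow> nat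
      \<Rightarrow> ((nat \<Rightarrow> real vec) \<Rightarrow> real vec \<Rightarrow> real) \<Rightarrow> real vec \<Rightarrow> real set" where
  "full_state_values A B0 B1 d x1 xf N J U =
     {J x U | x. full_state_admissible A B0 B1 d x1 xf N U x}"

end

theory Submission
  imports Defs "Jordan_Normal_Form.Determinant"
begin

text \<open>The terminal state is an affine function of the control: superposition gives
  \<open>x\<^sub>N = x\<^sub>N\<^sup>(\<^sup>0\<^sup>) + G U\<close>. The row normalizer is a diagonal matrix with nonzero diagonal,
  hence injective, so scaling the equation \<open>G U = x\<^sub>f - x\<^sub>N\<^sup>(\<^sup>0\<^sup>)\<close> by it does not change the
  solutions. The states accompanying a control are determined by it, so the two formulations
  have the same feasible controls and the same objective values.\<close>

section \<open>Invertibility of the scaling and dimensions of the data\<close>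

text \<open>A singular \<open>P\<close> has a nonzero kernel vector, at which the quadratic form
  would vanish.\<close>

lemma det_pos_def_mat_nonzero:
  assumes P: "P \<in> carrier_mat n n" and pd: "pos_def_mat P"
  shows "det P \<noteq> 0"
proof
  assume "det P = 0"
  then obtain v where v: "v \<in> carrier_vec n" "v \<noteq> 0\<^sub>v n" "P *\<^sub>v v = 0\<^sub>v n"
    using det_0_iff_vec_prod_zero[OF P] by blast
  with P pd have "v \<bullet> (P *\<^sub>v v) > 0"
    unfolding pos_def_mat_def by auto
  with v show False by simp
qed

text \<open>\<open>inv_mat\<close> applies \<open>the\<close> to an option, so its dimensions are
  known only once an inverse exists. A nonzero determinant makes \<open>M\<close> a unit of the
  matrix ring, which rules out \<open>None\<close>.\<close>

lemma inv_mat_carrier: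
  assumes M: "M \<in> carrier_mat n n" and det: "det M \<noteq> 0"
  shows "inv_mat M \<in> carrier_mat n n"
proof -
  have "M \<in> Units (ring_mat TYPE(real) n ())"
    by (rule det_non_zero_imp_unit[OF M det])
  with mat_inverse(1)[OF M, where b = "()"] obtain B where "mat_inverse M = Some B"
    by (cases "mat_inverse M") auto
  with mat_inverse(2)[OF M this] show ?thesis by (simp add: inv_mat_def)
qed

lemma blkdiag2_carrier:
  "P \<in> carrier_mat n n \<Longrightarrow> Q \<in> carrier_mat m m \<Longrightarrow> blkdiag2 P Q \<in> carrier_mat (n + m) (n + m)"
  unfolding blkdiag2_def by simp

lemma det_blkdiag2:
  assumes "P \<in> carrier_mat n n" and "Q \<in> carrier_mat m m"
  shows "det (blkdiag2 P Q) = det P * det Q"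
  unfolding blkdiag2_def
  using assms by (intro det_four_block_mat_upper_right_zero) auto

lemma dyn_A_carrier: "dyn_A dt \<in> carrier_mat 6 6"
  using four_block_carrier_mat[of "1\<^sub>m 3" 3 3 "1\<^sub>m 3" 3 3] by (simp add: dyn_A_def)

lemma dyn_B_carrier: "dyn_B dt \<in> carrier_mat 6 3"
  using carrier_append_rows[of "(dt\<^sup>2 / 4) \<cdot>\<^sub>m 1\<^sub>m 3" 3 3 "(dt / 2) \<cdot>\<^sub>m 1\<^sub>m 3" 3]
  by (simp add: dyn_B_def)

lemma dyn_d_carrier: "g \<in> carrier_vec 3 \<Longrightarrow> dyn_d dt g \<in> carrier_vec 6"
  using append_carrier_vec[of "(dt\<^sup>2 / 2) \<cdot>\<^sub>v g" 3 "dt \<cdot>\<^sub>v g" 3] by (simp add: dyn_d_def)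

section \<open>Injectivity of the row normalizer\<close>

lemma norm2_vec_nonzero:
  assumes v: "v \<in> carrier_vec n" and nz: "v \<noteq> 0\<^sub>v n"
  shows "norm2_vec v \<noteq> 0"
proof
  assume "norm2_vec v = 0"
  then have "(\<Sum>i = 0..<n. v $ i * v $ i) = 0"
    using v by (simp add: norm2_vec_def scalar_prod_def)
  then have "\<forall>i \<in> {0..<n}. v $ i * v $ i = 0"
    by (subst (asm) sum_nonneg_eq_0_iff) auto
  then have "v = 0\<^sub>v n"
    using v by (intro eq_vecI) auto
  with nz show False ..
qed

lemma index_mat_diag_mult_vec:
  fixes f :: "nat \<Rightarrow> 'a :: semiring_0"
  assumes v: "v \<in> carrier_vec n" and i: "i < n"
  shows "(mat_diag n f *\<^sub>v v) $ i = f i * v $ i"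
proof -
  have "(mat_diag n f *\<^sub>v v) $ i = (\<Sum>j \<in> {0..<n}. (if i = j then f j else 0) * v $ j)"
    using v i by (simp add: mat_diag_def scalar_prod_def)
  also have "\<dots> = (\<Sum>j \<in> {0..<n}. if j = i then f i * v $ i else 0)"
    by (rule sum.cong) auto
  also have "\<dots> = f i * v $ i" using i by simp
  finally show ?thesis .
qed

text \<open>Entry \<open>i\<close> of the product is \<open>v $ i\<close> divided by the norm of row
  \<open>i\<close> of \<open>G\<close>. That norm is nonzero, so it cancels entry by entry.\<close>

lemma row_normalizer_mult_vec_inj:
  assumes G: "G \<in> carrier_mat m n" and rows: "\<forall>i < m. row G i \<noteq> 0\<^sub>v n"
    and v: "v \<in> carrier_vec m" and w: "w \<in> carrier_vec m"
  shows "row_normalizer G *\<^sub>v v = row_normalizer G *\<^sub>v w \<longleftrightarrow> v = w"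
proof
  assume eq: "row_normalizer G *\<^sub>v v = row_normalizer G *\<^sub>v w"
  show "v = w"
  proof (rule eq_vecI)
    fix i assume "i < dim_vec w"
    with w have i: "i < m" by simp
    with G rows have "norm2_vec (row G i) \<noteq> 0"
      by (intro norm2_vec_nonzero[of _ n]) auto
    moreover have "(row_normalizer G *\<^sub>v v) $ i = (row_normalizer G *\<^sub>v w) $ i"
      using eq by simp
    ultimately show "v $ i = w $ i"
      using G v w i by (simp add: row_normalizer_def index_mat_diag_mult_vec)
  qed (use v w in simp)
qed simp

lemma control_block_carrier [simp]: "control_block U k \<in> carrier_vec 3"
  by (simp add: control_block_def)

lemma selector_carrier [simp]: "selector N k \<in> carrier_mat 3 (3 * N)"
  by (simp add: selector_def)

section \<open>Superposition for the affine dynamics\<close>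

text \<open>Superposition and uniqueness of the states hold for any affine recursion of these
  dimensions. The normalized data enter later by interpretation.\<close>

locale discrete_dynamics =
  fixes A B\<^sub>0 B\<^sub>1 :: "real mat" and d x\<^sub>1 :: "real vec"
  assumes A [simp]: "A \<in> carrier_mat 6 6"
    and B0 [simp]: "B\<^sub>0 \<in> carrier_mat 6 3"
    and B1 [simp]: "B\<^sub>1 \<in> carrier_mat 6 3"
    and d [simp]: "d \<in> carrier_vec 6"
    and x1 [simp]: "x\<^sub>1 \<in> carrier_vec 6"
begin

lemma zero_control_state_carrier [simp]: "zero_control_state A d x\<^sub>1 k \<in> carrier_vec 6"
  \<comment> \<open>The cases 0, 1 and \<open>Suc (Suc k)\<close> of this rule mirror the equations
    of the recursion, with its dummy value at 0.\<close>
  by (induction k rule: induct_nat_012) (auto intro!: add_carrier_vec mult_mat_vec_carrier[OF A])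

lemma sensitivity_carrier [simp]: "sensitivity A B\<^sub>0 B\<^sub>1 N k \<in> carrier_mat 6 (3 * N)"
  by (induction k rule: induct_nat_012)
    (auto intro!: add_carrier_mat mult_carrier_mat[OF B1 selector_carrier])

lemma generated_state_carrier [simp]: "generated_state A B\<^sub>0 B\<^sub>1 d x\<^sub>1 U k \<in> carrier_vec 6"
  by (induction k rule: induct_nat_012)
    (auto intro!: add_carrier_vec mult_mat_vec_carrier[OF A] mult_mat_vec_carrier[OF B0]
      mult_mat_vec_carrier[OF B1])

text \<open>Both sides obey the same recursion and agree at time 1, where the sensitivity is zero.
  The bound \<open>k \<le> N\<close> ensures that the selectors extract genuine blocks of
  \<open>U\<close>.\<close>

lemma generated_state_superposition:
  assumes U: "U \<in> carrier_vec (3 * N)" and "1 \<le> k" and "k \<le> N"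
  shows "generated_state A B\<^sub>0 B\<^sub>1 d x\<^sub>1 U k =
    zero_control_state A d x\<^sub>1 k + sensitivity A B\<^sub>0 B\<^sub>1 N k *\<^sub>v U"
  using \<open>1 \<le> k\<close> \<open>k \<le> N\<close>
proof (induction k rule: nat_induct_at_least)
  case base
  have "0\<^sub>m 6 (3 * N) *\<^sub>v U = 0\<^sub>v 6" using U by auto
  then show ?case by simp
next
  case (Suc k)
  \<comment> \<open>Writing \<open>k\<close> as a successor makes time \<open>Suc k\<close> match
    the \<open>Suc (Suc _)\<close> equations; the step from the dummy index 0 never occurs.\<close>
  then obtain m where m: "k = Suc m" by (cases k) auto
  let ?x = "zero_control_state A d x\<^sub>1 k" and ?G = "sensitivity A B\<^sub>0 B\<^sub>1 N k"
  let ?b = "B\<^sub>0 *\<^sub>v control_block U k" and ?c = "B\<^sub>1 *\<^sub>v control_block U (Suc k)"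
  have "sensitivity A B\<^sub>0 B\<^sub>1 N (Suc k) *\<^sub>v U
      = (A * ?G + B\<^sub>0 * selector N k + B\<^sub>1 * selector N (Suc k)) *\<^sub>v U"
    by (simp add: m)
  also have "\<dots> = A * ?G *\<^sub>v U + B\<^sub>0 * selector N k *\<^sub>v U + B\<^sub>1 * selector N (Suc k) *\<^sub>v U"
    using U mult_carrier_mat[OF A sensitivity_carrier] mult_carrier_mat[OF B0 selector_carrier]
      mult_carrier_mat[OF B1 selector_carrier]
    by (simp add: add_mult_distrib_mat_vec[of _ 6 "3 * N"])
  also have "\<dots> = A *\<^sub>v (?G *\<^sub>v U) + ?b + ?c"
    using U Suc.hyps Suc.prems
    by (simp add: assoc_mult_mat_vec[OF A sensitivity_carrier]
      assoc_mult_mat_vec[OF B0 selector_carrier] assoc_mult_mat_vec[OF B1 selector_carrier]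
      selector_mult_vec)
  finally have G: "sensitivity A B\<^sub>0 B\<^sub>1 N (Suc k) *\<^sub>v U = A *\<^sub>v (?G *\<^sub>v U) + ?b + ?c" .
  have GU: "?G *\<^sub>v U \<in> carrier_vec 6"
    using sensitivity_carrier U by (rule mult_mat_vec_carrier)
  \<comment> \<open>Vector addition obeys the usual laws only on a common carrier, so the regrouping
    into control-free and control-dependent terms is checked entrywise.\<close>
  have rearrange: "p + q + r + s + t = (p + t) + (q + r + s)"
    if "p \<in> carrier_vec 6" "q \<in> carrier_vec 6" "r \<in> carrier_vec 6" "s \<in> carrier_vec 6"
      "t \<in> carrier_vec 6" for p q r s t :: "real vec"
    using that by (intro eq_vecI) auto
  have "generated_state A B\<^sub>0 B\<^sub>1 d x\<^sub>1 U (Suc k) = A *\<^sub>v (?x + ?G *\<^sub>v U) + ?b + ?c + d"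
    using Suc by (simp add: m)
  also have "\<dots> = A *\<^sub>v ?x + A *\<^sub>v (?G *\<^sub>v U) + ?b + ?c + d"
    using GU by (simp add: mult_add_distrib_mat_vec[OF A])
  also have "\<dots> = (A *\<^sub>v ?x + d) + (A *\<^sub>v (?G *\<^sub>v U) + ?b + ?c)"
    using GU by (intro rearrange mult_mat_vec_carrier[OF A] mult_mat_vec_carrier[OF B0]
      mult_mat_vec_carrier[OF B1]) auto
  also have "A *\<^sub>v ?x + d = zero_control_state A d x\<^sub>1 (Suc k)"
    by (simp add: m)
  finally show ?case by (simp only: G)
qed

text \<open>Injectivity cancels the normalizer; moving the zero-control state to the other side then
  leaves the superposition formula at time \<open>N\<close>.\<close>

lemma terminal_condition_iff:
  assumes U: "U \<in> carrier_vec (3 * N)" and N: "1 \<le> N" and xf: "x\<^sub>f \<in> carrier_vec 6"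
    and rows: "\<forall>i < 6. row (sensitivity A B\<^sub>0 B\<^sub>1 N N) i \<noteq> 0\<^sub>v (3 * N)"
  defines "G \<equiv> sensitivity A B\<^sub>0 B\<^sub>1 N N"
  shows "(row_normalizer G * G) *\<^sub>v U = row_normalizer G *\<^sub>v (x\<^sub>f - zero_control_state A d x\<^sub>1 N) \<longleftrightarrow>
    generated_state A B\<^sub>0 B\<^sub>1 d x\<^sub>1 U N = x\<^sub>f"
proof -
  let ?D = "row_normalizer G" and ?x = "zero_control_state A d x\<^sub>1 N"
  have G: "G \<in> carrier_mat 6 (3 * N)" by (simp add: G_def)
  then have D: "?D \<in> carrier_mat 6 6" by (simp add: row_normalizer_def)
  have GU: "G *\<^sub>v U \<in> carrier_vec 6" using G U by (rule mult_mat_vec_carrier)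
  have x: "?x \<in> carrier_vec 6" by simp
  have "(?D * G) *\<^sub>v U = ?D *\<^sub>v (x\<^sub>f - ?x) \<longleftrightarrow> G *\<^sub>v U = x\<^sub>f - ?x"
    using row_normalizer_mult_vec_inj[OF G _ GU, of "x\<^sub>f - ?x"] rows xf
    unfolding assoc_mult_mat_vec[OF D G U] by (simp add: G_def)
  also have "\<dots> \<longleftrightarrow> ?x + G *\<^sub>v U = x\<^sub>f"
  proof
    assume "G *\<^sub>v U = x\<^sub>f - ?x"
    then show "?x + G *\<^sub>v U = x\<^sub>f" using xf by (intro eq_vecI) (auto simp: carrier_vecD[OF x])
  next
    assume "?x + G *\<^sub>v U = x\<^sub>f"
    then show "G *\<^sub>v U = x\<^sub>f - ?x" by (intro eq_vecI) (auto simp: carrier_vecD[OF x] carrier_matD[OF G])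
  qed
  also have "?x + G *\<^sub>v U = generated_state A B\<^sub>0 B\<^sub>1 d x\<^sub>1 U N"
    using generated_state_superposition[OF U N order_refl] by (simp add: G_def)
  finally show ?thesis .
qed

section \<open>States as functions of the control\<close>

text \<open>The initial condition and the dynamics fix the states one after another. Values of
  \<open>x\<close> outside \<open>1..N\<close> stay arbitrary, so equality is claimed on that range
  only.\<close>

lemma full_state_admissible_unique:
  assumes adm: "full_state_admissible A B\<^sub>0 B\<^sub>1 d x\<^sub>1 x\<^sub>f N U x" and "1 \<le> k" and "k \<le> N"
  shows "x k = generated_state A B\<^sub>0 B\<^sub>1 d x\<^sub>1 U k"
  using \<open>1 \<le> k\<close> \<open>k \<le> N\<close>
proof (induction k rule: nat_induct_at_least)
  case base
  then show ?case using adm by (simp add: full_state_admissible_def)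
next
  case (Suc k)
  then obtain m where "k = Suc m" by (cases k) auto
  with Suc adm show ?case by (simp add: full_state_admissible_def)
qed

text \<open>Taking the final state of the trajectory itself as target makes the terminal condition
  automatic, whatever the control.\<close>

lemma generated_state_admissible:
  "full_state_admissible A B\<^sub>0 B\<^sub>1 d x\<^sub>1 (generated_state A B\<^sub>0 B\<^sub>1 d x\<^sub>1 U N) N U
    (generated_state A B\<^sub>0 B\<^sub>1 d x\<^sub>1 U)"
proof -
  have "generated_state A B\<^sub>0 B\<^sub>1 d x\<^sub>1 U (k + 1) = A *\<^sub>v generated_state A B\<^sub>0 B\<^sub>1 d x\<^sub>1 U k
      + B\<^sub>0 *\<^sub>v control_block U k + B\<^sub>1 *\<^sub>v control_block U (k + 1) + d" if "k \<ge> 1" for k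
    using that by (cases k) auto
  then show ?thesis by (simp add: full_state_admissible_def)
qed

text \<open>Uniqueness at time \<open>N\<close> gives one direction; the generated trajectory is the
  witness for the other.\<close>

lemma ex_full_state_admissible_iff:
  assumes "1 \<le> N"
  shows "(\<exists>x. full_state_admissible A B\<^sub>0 B\<^sub>1 d x\<^sub>1 x\<^sub>f N U x) \<longleftrightarrow>
    generated_state A B\<^sub>0 B\<^sub>1 d x\<^sub>1 U N = x\<^sub>f"
proof
  assume "\<exists>x. full_state_admissible A B\<^sub>0 B\<^sub>1 d x\<^sub>1 x\<^sub>f N U x"
  then obtain x where x: "full_state_admissible A B\<^sub>0 B\<^sub>1 d x\<^sub>1 x\<^sub>f N U x" ..
  then have "x N = x\<^sub>f" by (simp add: full_state_admissible_def)
  with full_state_admissible_unique[OF x assms] show "generated_state A B\<^sub>0 B\<^sub>1 d x\<^sub>1 U N = x\<^sub>f"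
    by simp
qed (use generated_state_admissible in blast)

text \<open>Admissible states lie in the carrier on \<open>1..N\<close>, so \<open>J\<close> takes
  the value \<open>\<phi> U\<close> on each of them. The existence assumption keeps the set of
  values from being empty.\<close>

lemma full_state_values_control_only:
  assumes J: "control_only_objective N J \<phi>" and U: "U \<in> carrier_vec (3 * N)"
    and ex: "\<exists>x. full_state_admissible A B\<^sub>0 B\<^sub>1 d x\<^sub>1 x\<^sub>f N U x"
  shows "full_state_values A B\<^sub>0 B\<^sub>1 d x\<^sub>1 x\<^sub>f N J U = {\<phi> U}"
proof -
  have "J x U = \<phi> U" if "full_state_admissible A B\<^sub>0 B\<^sub>1 d x\<^sub>1 x\<^sub>f N U x" for x
    using J U that by (simp add: control_only_objective_def full_state_admissible_def)
  with ex show ?thesis unfolding full_state_values_def by force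
qed

end

theorem proposition1:
  fixes N :: nat and t\<^sub>f dt :: real
    and g x\<^sub>0 x\<^sub>f xhat\<^sub>1 xhat\<^sub>f dhat h\<^sub>c :: "real vec"
    and P\<^sub>r P\<^sub>v P\<^sub>u S\<^sub>x S\<^sub>u Ahat Bhat\<^sub>0 Bhat\<^sub>1 G D H\<^sub>c :: "real mat"
  assumes "N \<ge> 2" and "t\<^sub>f > 0" and "dt = t\<^sub>f / (real N - 1)"
    and "g \<in> carrier_vec 3" and "x\<^sub>0 \<in> carrier_vec 6" and "x\<^sub>f \<in> carrier_vec 6"
    and "P\<^sub>r \<in> carrier_mat 3 3" and "diagonal_mat P\<^sub>r" and "pos_def_mat P\<^sub>r"
    and "P\<^sub>v \<in> carrier_mat 3 3" and "diagonal_mat P\<^sub>v" and "pos_def_mat P\<^sub>v"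
    and "P\<^sub>u \<in> carrier_mat 3 3" and "diagonal_mat P\<^sub>u" and "pos_def_mat P\<^sub>u"
    and "S\<^sub>x = blkdiag2 P\<^sub>r P\<^sub>v" and "S\<^sub>u = P\<^sub>u"
    and "Ahat = inv_mat S\<^sub>x * dyn_A dt * S\<^sub>x"
    and "Bhat\<^sub>0 = inv_mat S\<^sub>x * dyn_B dt * S\<^sub>u"
    and "Bhat\<^sub>1 = inv_mat S\<^sub>x * dyn_B dt * S\<^sub>u"
    and "dhat = inv_mat S\<^sub>x *\<^sub>v dyn_d dt g"
    and "xhat\<^sub>1 = inv_mat S\<^sub>x *\<^sub>v x\<^sub>0"
    and "xhat\<^sub>f = inv_mat S\<^sub>x *\<^sub>v x\<^sub>f"
    and "G = sensitivity Ahat Bhat\<^sub>0 Bhat\<^sub>1 N N"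
    and "\<forall>i < 6. row G i \<noteq> 0\<^sub>v (3 * N)"
    and "D = row_normalizer G"
    and "H\<^sub>c = D * G"
    and "h\<^sub>c = D *\<^sub>v (xhat\<^sub>f - zero_control_state Ahat dhat xhat\<^sub>1 N)"
  shows "(\<forall>U \<in> carrier_vec (3 * N).
            H\<^sub>c *\<^sub>v U = h\<^sub>c \<longleftrightarrow> generated_state Ahat Bhat\<^sub>0 Bhat\<^sub>1 dhat xhat\<^sub>1 U N = xhat\<^sub>f) \<and>
         (\<forall>C \<subseteq> carrier_vec (3 * N).
            full_state_feasible Ahat Bhat\<^sub>0 Bhat\<^sub>1 dhat xhat\<^sub>1 xhat\<^sub>f N C = condensed_feasible H\<^sub>c h\<^sub>c C \<and>
            (\<forall>J \<phi>. control_only_objective N J \<phi> \<longrightarrow>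
               (\<forall>U \<in> condensed_feasible H\<^sub>c h\<^sub>c C.
                  full_state_values Ahat Bhat\<^sub>0 Bhat\<^sub>1 dhat xhat\<^sub>1 xhat\<^sub>f N J U = {\<phi> U})))"
proof -
  let ?x = "generated_state Ahat Bhat\<^sub>0 Bhat\<^sub>1 dhat xhat\<^sub>1"
  note Sx_eq = \<open>S\<^sub>x = blkdiag2 P\<^sub>r P\<^sub>v\<close>
  have Sx: "S\<^sub>x \<in> carrier_mat 6 6"
    using blkdiag2_carrier[OF \<open>P\<^sub>r \<in> carrier_mat 3 3\<close> \<open>P\<^sub>v \<in> carrier_mat 3 3\<close>] by (simp add: Sx_eq)
  \<comment> \<open>The determinant of the block diagonal matrix is the product of those of
    \<open>P\<^sub>r\<close> and \<open>P\<^sub>v\<close>, both nonzero by positive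
    definiteness.\<close>
  have "det S\<^sub>x \<noteq> 0"
    using det_blkdiag2[OF \<open>P\<^sub>r \<in> carrier_mat 3 3\<close> \<open>P\<^sub>v \<in> carrier_mat 3 3\<close>]
      det_pos_def_mat_nonzero[OF \<open>P\<^sub>r \<in> carrier_mat 3 3\<close> \<open>pos_def_mat P\<^sub>r\<close>]
      det_pos_def_mat_nonzero[OF \<open>P\<^sub>v \<in> carrier_mat 3 3\<close> \<open>pos_def_mat P\<^sub>v\<close>]
    by (simp add: Sx_eq)
  with Sx have inv: "inv_mat S\<^sub>x \<in> carrier_mat 6 6" by (rule inv_mat_carrier)
  interpret discrete_dynamics Ahat Bhat\<^sub>0 Bhat\<^sub>1 dhat xhat\<^sub>1
  proof
    show "Ahat \<in> carrier_mat 6 6"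
      unfolding \<open>Ahat = _\<close> using inv dyn_A_carrier Sx by (intro mult_carrier_mat)
    show "Bhat\<^sub>0 \<in> carrier_mat 6 3"
      unfolding \<open>Bhat\<^sub>0 = _\<close> \<open>S\<^sub>u = P\<^sub>u\<close>
      using inv dyn_B_carrier \<open>P\<^sub>u \<in> carrier_mat 3 3\<close> by (intro mult_carrier_mat)
    show "Bhat\<^sub>1 \<in> carrier_mat 6 3"
      unfolding \<open>Bhat\<^sub>1 = _\<close> \<open>S\<^sub>u = P\<^sub>u\<close>
      using inv dyn_B_carrier \<open>P\<^sub>u \<in> carrier_mat 3 3\<close> by (intro mult_carrier_mat)
    show "dhat \<in> carrier_vec 6"
      unfolding \<open>dhat = _\<close> using inv dyn_d_carrier[OF \<open>g \<in> carrier_vec 3\<close>] by (rule mult_mat_vec_carrier)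
    show "xhat\<^sub>1 \<in> carrier_vec 6"
      unfolding \<open>xhat\<^sub>1 = _\<close> using inv \<open>x\<^sub>0 \<in> carrier_vec 6\<close> by (rule mult_mat_vec_carrier)
  qed
  have N: "1 \<le> N" using \<open>N \<ge> 2\<close> by simp
  have xf: "xhat\<^sub>f \<in> carrier_vec 6"
    unfolding \<open>xhat\<^sub>f = _\<close> using inv \<open>x\<^sub>f \<in> carrier_vec 6\<close> by (rule mult_mat_vec_carrier)
  have terminal: "H\<^sub>c *\<^sub>v U = h\<^sub>c \<longleftrightarrow> ?x U N = xhat\<^sub>f" if "U \<in> carrier_vec (3 * N)" for U
    using terminal_condition_iff[OF that N xf] \<open>\<forall>i < 6. row G i \<noteq> 0\<^sub>v (3 * N)\<close>
    unfolding \<open>H\<^sub>c = _\<close> \<open>h\<^sub>c = _\<close> \<open>D = _\<close> \<open>G = _\<close> by blast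
  \<comment> \<open>Both sides are equivalent to the generated trajectory ending at
    \<open>xhat\<^sub>f\<close>, which eliminates the states from the feasibility condition.\<close>
  have admissible: "(\<exists>x. full_state_admissible Ahat Bhat\<^sub>0 Bhat\<^sub>1 dhat xhat\<^sub>1 xhat\<^sub>f N U x) \<longleftrightarrow>
      H\<^sub>c *\<^sub>v U = h\<^sub>c"
    if "U \<in> carrier_vec (3 * N)" for U
    using ex_full_state_admissible_iff[OF N] terminal[OF that] by simp
  show ?thesis
  proof (intro conjI allI impI ballI)
    fix U :: "real vec" assume "U \<in> carrier_vec (3 * N)"
    then show "H\<^sub>c *\<^sub>v U = h\<^sub>c \<longleftrightarrow> ?x U N = xhat\<^sub>f" by (rule terminal)
  next
    fix C :: "real vec set" assume "C \<subseteq> carrier_vec (3 * N)"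
    with admissible
    show "full_state_feasible Ahat Bhat\<^sub>0 Bhat\<^sub>1 dhat xhat\<^sub>1 xhat\<^sub>f N C =
      condensed_feasible H\<^sub>c h\<^sub>c C"
      unfolding full_state_feasible_def condensed_feasible_def by blast
  next
    fix C :: "real vec set" and J \<phi> and U :: "real vec"
    assume "C \<subseteq> carrier_vec (3 * N)" and J: "control_only_objective N J \<phi>"
      and "U \<in> condensed_feasible H\<^sub>c h\<^sub>c C"
    then have U: "U \<in> carrier_vec (3 * N)" "H\<^sub>c *\<^sub>v U = h\<^sub>c"
      by (auto simp: condensed_feasible_def)
    \<comment> \<open>The condensed equation supplies an admissible trajectory, so the full-state
      formulation attains a value at \<open>U\<close>.\<close>
    with admissible show "full_state_values Ahat Bhat\<^sub>0 Bhat\<^sub>1 dhat xhat\<^sub>1 xhat\<^sub>f N J U = {\<phi> U}"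
      by (intro full_state_values_control_only[OF J]) auto
  qed
qed

end
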